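(* Let $\nu_1:L_{\mathrm d}^2\to\mathbb R$ be $L$-smooth, and let $\nu_2,\nu_3:L_{\mathrm d}^2\to\mathbb R$ be $\mu_2$-strongly convex and $\mu_3$-strongly convex, respectively, with $\mu_2\ge 0$. Let $\Delta t>0$ and let $(U^{(n)})_{n\ge0}$ be a sequence in $L_{\mathrm d}^2$ satisfying, for all $n\ge 0$, $$\frac{U^{(n+1)}-U^{(n)}}{\Delta t}=-\left\{\nabla_{L_{\mathrm d}^2}\nu_1(U^{(n)})+\nabla_{L_{\mathrm d}^2}\nu_2(U^{(n+1)})-\nabla_{L_{\mathrm d}^2}\nu_3(U^{(n)})\right\}.$$ Put $\nu_{\mathrm{total}}:=\nu_1+\nu_2-\nu_3$. If either $L\le\mu_2+\mu_3$, or $L>\mu_2+\mu_3$ and $\Delta t\le\frac{2}{L-\mu_2-\mu_3}$, then $\nu_{\mathrm{total}}(U^{(n)})$ is non-increasing in $n$.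
   Context: Fix lengths $\ell_x,\ell_y,\ell_z>0$, positive integers $N_x,N_y,N_z$, and mesh sizes $\Delta x=\ell_x/N_x$, $\Delta y=\ell_y/N_y$, $\Delta z=\ell_z/N_z$. $L_{\mathrm d}^2$ is the real vector space of arrays $f=(f_{i,j,k})$ with $0\le i\le N_x$, $0\le j\le N_y$, $0\le k\le N_z$. It carries the inner product $\langle f,g\rangle_{L_{\mathrm d}^2}=\sum''_{i}\sum''_{j}\sum''_{k}f_{i,j,k}g_{i,j,k}\,\Delta x\Delta y\Delta z$, where $\sum''_{i=0}^{N}a_i=\frac{a_0}{2}+a_1+\dots+a_{N-1}+\frac{a_N}{2}$, and the norm $\|f\|_{L_{\mathrm d}^2}=\langle f,f\rangle_{L_{\mathrm d}^2}^{1/2}$. Gradient: for $\nu:L_{\mathrm d}^2\to\mathbb R$ and $f\in L_{\mathrm d}^2$, if $\lim_{\Lambda\to+0}\frac{\nu(f+\Lambda h)-\nu(f)}{\Lambda}$ exists for all $h$ and is linear and continuous in $h$, then $\nabla_{L_{\mathrm d}^2}\nu(f)\in L_{\mathrm d}^2$ is the unique element with $\lim_{\Lambda\to+0}\frac{\nu(f+\Lambda h)-\nu(f)}{\Lambda}=\langle\nabla_{L_{\mathrm d}^2}\nu(f),h\rangle_{L_{\mathrm d}^2}$ for all $h$. $\nu$ is $L$-smooth ($L>0$) if its gradient exists everywhere and $\|\nabla_{L_{\mathrm d}^2}\nu(f)-\nabla_{L_{\mathrm d}^2}\nu(g)\|_{L_{\mathrm d}^2}\le L\|f-g\|_{L_{\mathrm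 d}^2}$ for all $f,g$. $\nu$ is $\mu$-strongly convex ($\mu\in\mathbb R$) if its gradient exists everywhere and $\nu(g)\ge\nu(f)+\langle\nabla_{L_{\mathrm d}^2}\nu(f),g-f\rangle_{L_{\mathrm d}^2}+\frac{\mu}{2}\|g-f\|_{L_{\mathrm d}^2}^2$ for all $f,g$. *)

theory Defs
  imports "HOL-Analysis.Analysis" "HOL-Library.Function_Algebras"
begin

record grid =
  len_x :: real
  len_y :: real
  len_z :: real
  num_x :: nat
  num_y :: nat
  num_z :: nat

definition valid_grid :: "grid \<Rightarrow> bool" where
  "valid_grid G \<longleftrightarrow>
     len_x G > 0 \<and> len_y G > 0 \<and> len_z G > 0 \<and> num_x G > 0 \<and> num_y G > 0 \<and> num_z G > 0"

definition mesh_x :: "grid \<Rightarrow> real" where "mesh_x G = len_x G / real (num_x G)"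
definition mesh_y :: "grid \<Rightarrow> real" where "mesh_y G = len_y G / real (num_y G)"
definition mesh_z :: "grid \<Rightarrow> real" where "mesh_z G = len_z G / real (num_z G)"

type_synonym arr = "nat \<Rightarrow> nat \<Rightarrow> nat \<Rightarrow> real"

text \<open>
  An array on the grid is represented by its extension by zero to all index triples, so that
  equality of functions is equality of arrays. Sums, differences, negation and zero are
  pointwise. A functional on \<open>Ld2 G\<close> is a
  function on all of \<^typ>\<open>arr\<close> of which the notions below use only the values on \<open>Ld2 G\<close>.
\<close>

definition Ld2 :: "grid \<Rightarrow> arr set" where
  "Ld2 G = {f. \<forall>i j k. \<not> (i \<le> num_x G \<and> j \<le> num_y G \<and> k \<le> num_z G) \<longrightarrow> f i j k = 0}"

definition arr_scale :: "real \<Rightarrow> arr \<Rightarrow> arr" (infixr "*\<^sub>a" 75) where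
  "c *\<^sub>a f = (\<lambda>i j k. c * f i j k)"

text \<open>The sum over \<open>0, \<dots>, N\<close> whose two end terms have weight one half (meant for \<open>N > 0\<close>).\<close>

definition sum_trap :: "nat \<Rightarrow> (nat \<Rightarrow> real) \<Rightarrow> real" where
  "sum_trap N a = a 0 / 2 + (\<Sum>i = 1..<N. a i) + a N / 2"

definition inner_Ld2 :: "grid \<Rightarrow> arr \<Rightarrow> arr \<Rightarrow> real" where
  "inner_Ld2 G f g =
     sum_trap (num_x G) (\<lambda>i. sum_trap (num_y G) (\<lambda>j. sum_trap (num_z G) (\<lambda>k.
       f i j k * g i j k * mesh_x G * mesh_y G * mesh_z G)))"

definition norm_Ld2 :: "grid \<Rightarrow> arr \<Rightarrow> real" where
  "norm_Ld2 G f = sqrt (inner_Ld2 G f f)"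

definition linear_Ld2 :: "grid \<Rightarrow> (arr \<Rightarrow> real) \<Rightarrow> bool" where
  "linear_Ld2 G D \<longleftrightarrow>
     (\<forall>f\<in>Ld2 G. \<forall>g\<in>Ld2 G. D (f + g) = D f + D g) \<and>
     (\<forall>c. \<forall>f\<in>Ld2 G. D (c *\<^sub>a f) = c * D f)"

definition continuous_Ld2 :: "grid \<Rightarrow> (arr \<Rightarrow> real) \<Rightarrow> bool" where
  "continuous_Ld2 G D \<longleftrightarrow>
     (\<forall>f\<in>Ld2 G. \<forall>\<epsilon>>0. \<exists>\<delta>>0. \<forall>g\<in>Ld2 G. norm_Ld2 G (g - f) < \<delta> \<longrightarrow> \<bar>D g - D f\<bar> < \<epsilon>)"

definition has_dir_deriv :: "(arr \<Rightarrow> real) \<Rightarrow> arr \<Rightarrow> arr \<Rightarrow> real \<Rightarrow> bool" where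
  "has_dir_deriv \<nu> f h d \<longleftrightarrow>
     ((\<lambda>\<Lambda>. (\<nu> (f + \<Lambda> *\<^sub>a h) - \<nu> f) / \<Lambda>) \<longlongrightarrow> d) (at_right 0)"

definition gradient_exists :: "grid \<Rightarrow> (arr \<Rightarrow> real) \<Rightarrow> arr \<Rightarrow> bool" where
  "gradient_exists G \<nu> f \<longleftrightarrow>
     (\<exists>D. (\<forall>h\<in>Ld2 G. has_dir_deriv \<nu> f h (D h)) \<and> linear_Ld2 G D \<and> continuous_Ld2 G D)"

text \<open>Meaningful only where \<^const>\<open>gradient_exists\<close> holds.\<close>

definition grad_Ld2 :: "grid \<Rightarrow> (arr \<Rightarrow> real) \<Rightarrow> arr \<Rightarrow> arr" where
  "grad_Ld2 G \<nu> f =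
     (THE u. u \<in> Ld2 G \<and> (\<forall>h\<in>Ld2 G. has_dir_deriv \<nu> f h (inner_Ld2 G u h)))"

definition L_smooth :: "grid \<Rightarrow> real \<Rightarrow> (arr \<Rightarrow> real) \<Rightarrow> bool" where
  "L_smooth G L \<nu> \<longleftrightarrow>
     L > 0 \<and>
     (\<forall>f\<in>Ld2 G. gradient_exists G \<nu> f) \<and>
     (\<forall>f\<in>Ld2 G. \<forall>g\<in>Ld2 G.
        norm_Ld2 G (grad_Ld2 G \<nu> f - grad_Ld2 G \<nu> g) \<le> L * norm_Ld2 G (f - g))"

definition strongly_convex :: "grid \<Rightarrow> real \<Rightarrow> (arr \<Rightarrow> real) \<Rightarrow> bool" where
  "strongly_convex G \<mu> \<nu> \<longleftrightarrow>
     (\<forall>f\<in>Ld2 G. gradient_exists G \<nu> f) \<and>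
     (\<forall>f\<in>Ld2 G. \<forall>g\<in>Ld2 G.
        \<nu> g \<ge> \<nu> f + inner_Ld2 G (grad_Ld2 G \<nu> f) (g - f) + \<mu> / 2 * (norm_Ld2 G (g - f))\<^sup>2)"

end

theory Submission imports Defs begin

text \<open>
  Write \<open>d = U (n + 1) - U n\<close>. The descent lemma for \<open>\<nu>1\<close>, strong convexity of \<open>\<nu>2\<close> based at
  \<open>U (n + 1)\<close> and strong convexity of \<open>\<nu>3\<close> based at \<open>U n\<close> add up to a bound of the increment of
  the total energy by \<open>\<langle>g, d\<rangle> + (L - \<mu>2 - \<mu>3) / 2 * \<parallel>d\<parallel>\<^sup>2\<close>, where \<open>g\<close> is the combination of
  gradients in the scheme. As \<open>g = - d / \<Delta>t\<close>, the step size condition makes this nonpositive.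
\<close>

section \<open>Arrays as functions on a finite index set with a weighted inner product\<close>

definition grid_points :: "grid \<Rightarrow> (nat \<times> nat \<times> nat) set" where
  "grid_points G = {..num_x G} \<times> {..num_y G} \<times> {..num_z G}"

definition trap_weight :: "nat \<Rightarrow> nat \<Rightarrow> real" where
  "trap_weight N i = (if i = 0 \<or> i = N then 1 / 2 else 1)"

definition point_weight :: "grid \<Rightarrow> nat \<times> nat \<times> nat \<Rightarrow> real" where
  "point_weight G = (\<lambda>(i, j, k). trap_weight (num_x G) i * trap_weight (num_y G) j *
     trap_weight (num_z G) k * (mesh_x G * mesh_y G * mesh_z G))"

definition at_point :: "arr \<Rightarrow> nat \<times> nat \<times> nat \<Rightarrow> real" where
  "at_point f = (\<lambda>(i, j, k). f i j k)"

definition unit_arr :: "nat \<times> nat \<times> nat \<Rightarrow> arr" where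
  "unit_arr p = (\<lambda>i j k. of_bool (p = (i, j, k)))"

lemma at_point_simps [simp]:
  "at_point (f + g) p = at_point f p + at_point g p"
  "at_point (f - g) p = at_point f p - at_point g p"
  "at_point (- f) p = - at_point f p"
  "at_point (c *\<^sub>a f) p = c * at_point f p"
  "at_point 0 p = 0"
  "at_point (unit_arr q) p = of_bool (q = p)"
  by (auto simp: at_point_def arr_scale_def unit_arr_def split: prod.splits)

lemma arr_eqI: "(\<And>p. at_point f p = at_point g p) \<Longrightarrow> f = g"
  unfolding at_point_def by (intro ext) (metis case_prod_conv)

lemma Ld2_iff: "f \<in> Ld2 G \<longleftrightarrow> (\<forall>p. p \<notin> grid_points G \<longrightarrow> at_point f p = 0)"
  by (auto simp: Ld2_def grid_points_def at_point_def)

lemma finite_grid_points [simp]: "finite (grid_points G)"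
  by (simp add: grid_points_def)

text \<open>Positivity keeps the two end points distinct. For \<open>N = 0\<close> the left side
  would count \<open>a 0\<close> fully and the right side only half of it.\<close>

lemma sum_trap_eq:
  assumes "N > 0"
  shows "sum_trap N a = (\<Sum>i\<le>N. trap_weight N i * a i)"
proof -
  have "{..N} = insert 0 (insert N {1..<N})"
    using assms by auto
  moreover have "(\<Sum>i=1..<N. trap_weight N i * a i) = (\<Sum>i=1..<N. a i)"
    by (rule sum.cong) (auto simp: trap_weight_def)
  ultimately show ?thesis
    using assms by (simp add: sum_trap_def trap_weight_def)
qed

lemma point_weight_pos:
  assumes "valid_grid G"
  shows "point_weight G p > 0"
  using assms by (auto simp: valid_grid_def point_weight_def trap_weight_def
      mesh_x_def mesh_y_def mesh_z_def split: prod.splits)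

text \<open>Flattening the nested sums to one finite sum with positive weights reduces the inner
  product axioms and Cauchy-Schwarz to facts about \<open>sum\<close>.\<close>

lemma inner_Ld2_eq:
  assumes "valid_grid G"
  shows "inner_Ld2 G f g =
    (\<Sum>p\<in>grid_points G. point_weight G p * (at_point f p * at_point g p))"
  using assms
  by (simp add: inner_Ld2_def valid_grid_def sum_trap_eq grid_points_def point_weight_def
      at_point_def sum.cartesian_product' sum_distrib_left mult_ac)

lemma inner_Ld2_algebra:
  assumes "valid_grid G"
  shows "inner_Ld2 G (f + g) h = inner_Ld2 G f h + inner_Ld2 G g h"
    and "inner_Ld2 G (f - g) h = inner_Ld2 G f h - inner_Ld2 G g h"
    and "inner_Ld2 G f (g - h) = inner_Ld2 G f g - inner_Ld2 G f h"
    and "inner_Ld2 G (- f) h = - inner_Ld2 G f h"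
    and "inner_Ld2 G f (- h) = - inner_Ld2 G f h"
    and "inner_Ld2 G (c *\<^sub>a f) h = c * inner_Ld2 G f h"
    and "inner_Ld2 G f (c *\<^sub>a h) = c * inner_Ld2 G f h"
  by (simp_all add: inner_Ld2_eq[OF assms] algebra_simps sum.distrib sum_subtractf
      sum_negf sum_distrib_left)

lemma inner_Ld2_nonneg:
  assumes "valid_grid G"
  shows "inner_Ld2 G f f \<ge> 0"
  unfolding inner_Ld2_eq[OF assms]
  by (intro sum_nonneg mult_nonneg_nonneg less_imp_le[OF point_weight_pos] assms zero_le_square)

lemma norm_Ld2_squared:
  assumes "valid_grid G"
  shows "(norm_Ld2 G f)\<^sup>2 = inner_Ld2 G f f"
  using inner_Ld2_nonneg[OF assms] by (simp add: norm_Ld2_def)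

lemma norm_Ld2_scale:
  assumes "valid_grid G"
  shows "norm_Ld2 G (c *\<^sub>a f) = \<bar>c\<bar> * norm_Ld2 G f"
  by (simp add: norm_Ld2_def inner_Ld2_algebra[OF assms] real_sqrt_mult flip: mult.assoc)

text \<open>The inner product sees only the grid points, where positive weights force the values to
  vanish; elsewhere membership in \<open>Ld2 G\<close> does so.\<close>

lemma inner_Ld2_self_eq_0:
  assumes "valid_grid G" "f \<in> Ld2 G" "inner_Ld2 G f f = 0"
  shows "f = 0"
proof (rule arr_eqI)
  fix p
  have "\<forall>p\<in>grid_points G. point_weight G p * (at_point f p * at_point f p) = 0"
    using assms(3) unfolding inner_Ld2_eq[OF assms(1)]
    by (subst (asm) sum_nonneg_eq_0_iff)
       (simp_all add: less_imp_le[OF point_weight_pos[OF assms(1)]])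
  then show "at_point f p = at_point 0 p"
    using point_weight_pos[OF assms(1), of p] assms(2) unfolding Ld2_iff
    by (cases "p \<in> grid_points G") (auto simp del: split_paired_All split_paired_Ball_Sigma)
qed

text \<open>Cauchy-Schwarz, reduced to the unweighted inequality for sums by moving a square root of
  the weight into each factor.\<close>

lemma inner_Ld2_le_norm:
  assumes "valid_grid G"
  shows "inner_Ld2 G f g \<le> norm_Ld2 G f * norm_Ld2 G g"
proof -
  define w where "w p = sqrt (point_weight G p)" for p
  have w: "point_weight G p = w p * w p" for p
    using point_weight_pos[OF assms, of p] by (simp add: w_def)
  have "(inner_Ld2 G f g)\<^sup>2 \<le> inner_Ld2 G f f * inner_Ld2 G g g"
    using Cauchy_Schwarz_ineq_sum[of "\<lambda>p. w p * at_point f p" "\<lambda>p. w p * at_point g p"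
        "grid_points G"]
    by (simp add: inner_Ld2_eq[OF assms] w power2_eq_square mult_ac)
  then show ?thesis
    by (simp add: norm_Ld2_def real_le_rsqrt flip: real_sqrt_mult)
qed

section \<open>Riesz representation of linear functionals\<close>

lemma linear_Ld2_expansion:
  assumes D: "linear_Ld2 G D"
    and "finite A" "A \<subseteq> grid_points G" "\<And>p. p \<notin> A \<Longrightarrow> at_point h p = 0"
  shows "D h = (\<Sum>p\<in>A. at_point h p * D (unit_arr p))"
  using assms(2-)
proof (induction A arbitrary: h rule: finite_induct)
  case empty
  \<comment> \<open>Here \<open>h\<close> vanishes everywhere, so it equals zero times itself and
    homogeneity yields \<open>D h = 0\<close>.\<close>
  then have "h = 0 *\<^sub>a h" "h \<in> Ld2 G"
    by (auto intro: arr_eqI simp: Ld2_iff)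
  then have "D h = 0 * D h"
    using D by (metis linear_Ld2_def)
  then show ?case by simp
next
  case (insert q A)
  \<comment> \<open>Removing the contribution of \<open>q\<close> leaves an array supported in
    \<open>A\<close>, which the induction hypothesis covers.\<close>
  define h' where "h' = h - at_point h q *\<^sub>a unit_arr q"
  have h': "at_point h' p = (if p = q then 0 else at_point h p)" for p
    by (simp add: h'_def)
  have "at_point h p = 0" if "p \<notin> grid_points G" for p
    using insert.prems that by blast
  then have mem: "h' \<in> Ld2 G" "unit_arr q \<in> Ld2 G" "at_point h q *\<^sub>a unit_arr q \<in> Ld2 G"
    using insert.prems(1) by (auto simp: Ld2_iff h')
  have "D h = D (h' + at_point h q *\<^sub>a unit_arr q)"
    by (simp add: h'_def)
  also have "\<dots> = D h' + at_point h q * D (unit_arr q)"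
    using D mem by (simp add: linear_Ld2_def)
  also have "D h' = (\<Sum>p\<in>A. at_point h' p * D (unit_arr p))"
    using insert.prems by (intro insert.IH) (simp_all add: h')
  also have "\<dots> = (\<Sum>p\<in>A. at_point h p * D (unit_arr p))"
    using insert.hyps by (intro sum.cong) (auto simp: h')
  finally show ?case
    using insert.hyps by simp
qed

text \<open>The value of \<open>D\<close> on each unit array is divided by the weight of that point,
  so that the weight in the inner product cancels.\<close>

lemma linear_Ld2_representable:
  assumes G: "valid_grid G" and D: "linear_Ld2 G D"
  obtains u where "u \<in> Ld2 G" "\<And>h. h \<in> Ld2 G \<Longrightarrow> D h = inner_Ld2 G u h"
proof
  define u :: arr where "u = (\<lambda>i j k. if (i, j, k) \<in> grid_points G
    then D (unit_arr (i, j, k)) / point_weight G (i, j, k) else 0)"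
  have u: "at_point u p =
      (if p \<in> grid_points G then D (unit_arr p) / point_weight G p else 0)" for p
    by (cases p) (simp add: u_def at_point_def)
  then show "u \<in> Ld2 G"
    by (simp add: Ld2_iff)
  fix h assume "h \<in> Ld2 G"
  then have "D h = (\<Sum>p\<in>grid_points G. at_point h p * D (unit_arr p))"
    by (intro linear_Ld2_expansion[OF D]) (auto simp: Ld2_iff)
  also have "\<dots> = inner_Ld2 G u h"
    unfolding inner_Ld2_eq[OF G] using point_weight_pos[OF G]
    by (intro sum.cong) (auto simp: u less_imp_neq[symmetric])
  finally show "D h = inner_Ld2 G u h" .
qed

section \<open>Gradients, derivatives along lines and the descent lemma\<close>

lemma has_dir_deriv_unique:
  "has_dir_deriv \<nu> f h c \<Longrightarrow> has_dir_deriv \<nu> f h d \<Longrightarrow> c = d"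
  unfolding has_dir_deriv_def by (rule tendsto_unique[rotated]) auto

text \<open>This justifies the definite description in \<open>grad_Ld2\<close>. Existence is the
  Riesz representation; for uniqueness, the difference of two candidates serves as the test
  direction and turns out orthogonal to itself.\<close>

lemma has_dir_deriv_grad:
  assumes G: "valid_grid G" and ex: "gradient_exists G \<nu> f" and h: "h \<in> Ld2 G"
  shows "has_dir_deriv \<nu> f h (inner_Ld2 G (grad_Ld2 G \<nu> f) h)"
proof -
  let ?P = "\<lambda>u. u \<in> Ld2 G \<and> (\<forall>h\<in>Ld2 G. has_dir_deriv \<nu> f h (inner_Ld2 G u h))"
  obtain D where D: "\<forall>h\<in>Ld2 G. has_dir_deriv \<nu> f h (D h)" "linear_Ld2 G D"
    using ex by (auto simp: gradient_exists_def)
  obtain u where u: "?P u"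
    using linear_Ld2_representable[OF G D(2)] D(1) by metis
  have "v = u" if v: "?P v" for v
  proof -
    have mem: "v - u \<in> Ld2 G"
      using u v by (simp add: Ld2_iff)
    then have "inner_Ld2 G v (v - u) = inner_Ld2 G u (v - u)"
      using u v has_dir_deriv_unique by blast
    then have "v - u = 0"
      by (intro inner_Ld2_self_eq_0[OF G mem]) (simp add: inner_Ld2_algebra[OF G])
    then show ?thesis by simp
  qed
  then have "?P (grad_Ld2 G \<nu> f)"
    unfolding grad_Ld2_def using u by (intro theI[of ?P u]) blast+
  then show ?thesis using h by blast
qed

text \<open>Directional derivatives are one-sided. The direction \<open>d\<close> gives the limit
  from the right, and \<open>- d\<close> gives the one from the left; they agree because the
  gradient pairing is linear in the direction.\<close>

lemma has_real_derivative_along_line: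
  assumes G: "valid_grid G" and ex: "gradient_exists G \<nu> (a + t *\<^sub>a d)" and d: "d \<in> Ld2 G"
  shows "((\<lambda>s. \<nu> (a + s *\<^sub>a d)) has_real_derivative
    inner_Ld2 G (grad_Ld2 G \<nu> (a + t *\<^sub>a d)) d) (at t)"
proof -
  let ?f = "a + t *\<^sub>a d"
  let ?c = "inner_Ld2 G (grad_Ld2 G \<nu> ?f) d"
  let ?q = "\<lambda>s. (\<nu> (a + (t + s) *\<^sub>a d) - \<nu> ?f) / s"
  have eq: "a + (t + s) *\<^sub>a d = ?f + s *\<^sub>a d" "s *\<^sub>a (- d) = (- s) *\<^sub>a d" for s
    by (auto intro: arr_eqI simp: algebra_simps)
  have "- d \<in> Ld2 G"
    using d by (simp add: Ld2_iff)
  from has_dir_deriv_grad[OF G ex this]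
  have "((\<lambda>s. (\<nu> (?f + s *\<^sub>a (- d)) - \<nu> ?f) / s) \<longlongrightarrow> - ?c) (at_right 0)"
    by (simp only: has_dir_deriv_def inner_Ld2_algebra[OF G])
  \<comment> \<open>Substituting \<open>- s\<close> for \<open>s\<close> changes the sign of the
    denominator, which the negated limit compensates.\<close>
  from tendsto_minus[OF this] have "(?q \<longlongrightarrow> ?c) (at_left 0)"
    by (simp add: filterlim_at_left_to_right eq)
  moreover have "(?q \<longlongrightarrow> ?c) (at_right 0)"
    using has_dir_deriv_grad[OF G ex d] by (simp add: has_dir_deriv_def eq)
  ultimately show ?thesis
    unfolding DERIV_def by (rule filterlim_split_at)
qed

text \<open>Monotonicity of an auxiliary function on the segment from \<open>a\<close> to
  \<open>b\<close> takes the place of integrating the gradient.\<close>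

lemma descent_lemma:
  assumes G: "valid_grid G" and sm: "L_smooth G L \<nu>" and a: "a \<in> Ld2 G" and b: "b \<in> Ld2 G"
  shows "\<nu> b \<le> \<nu> a + inner_Ld2 G (grad_Ld2 G \<nu> a) (b - a) + L / 2 * (norm_Ld2 G (b - a))\<^sup>2"
proof -
  define d where "d = b - a"
  define g where "g t = grad_Ld2 G \<nu> (a + t *\<^sub>a d)" for t
  \<comment> \<open>The claim is \<open>\<psi> 1 \<le> \<psi> 0\<close>. The quadratic term is
    chosen so that its derivative \<open>L * t * (norm_Ld2 G d)\<^sup>2\<close> absorbs the change
    of the gradient between parameters \<open>0\<close> and \<open>t\<close>.\<close>
  define \<psi> where "\<psi> t = \<nu> (a + t *\<^sub>a d) - t * inner_Ld2 G (g 0) d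
    - L / 2 * t\<^sup>2 * (norm_Ld2 G d)\<^sup>2" for t
  have d: "d \<in> Ld2 G" and line: "a + t *\<^sub>a d \<in> Ld2 G" for t
    using a b by (auto simp: d_def Ld2_iff)
  have [simp]: "a + 0 *\<^sub>a d = a" "a + 1 *\<^sub>a d = b"
    by (auto intro: arr_eqI simp: d_def)
  have "\<psi> 1 \<le> \<psi> 0"
  proof (rule DERIV_nonpos_imp_nonincreasing[of 0 1 \<psi>])
    fix t :: real assume t: "0 \<le> t" "t \<le> 1"
    let ?D = "inner_Ld2 G (g t) d - inner_Ld2 G (g 0) d - L * t * (norm_Ld2 G d)\<^sup>2"
    have "gradient_exists G \<nu> (a + t *\<^sub>a d)"
      using sm line by (simp add: L_smooth_def)
    note deriv = has_real_derivative_along_line[OF G this d, folded g_def]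
    have "(\<psi> has_real_derivative ?D) (at t)"
      unfolding \<psi>_def by (auto intro!: derivative_eq_intros deriv)
    moreover have "?D \<le> 0"
    proof -
      have "norm_Ld2 G (g t - g 0) \<le> L * norm_Ld2 G ((a + t *\<^sub>a d) - (a + 0 *\<^sub>a d))"
        using sm line[of t] line[of 0] unfolding g_def L_smooth_def by blast
      also have "\<dots> = L * (t * norm_Ld2 G d)"
        using t by (simp add: norm_Ld2_scale[OF G])
      finally have lip: "norm_Ld2 G (g t - g 0) \<le> L * (t * norm_Ld2 G d)" .
      have "inner_Ld2 G (g t - g 0) d \<le> norm_Ld2 G (g t - g 0) * norm_Ld2 G d"
        by (rule inner_Ld2_le_norm[OF G])
      also have "\<dots> \<le> L * (t * norm_Ld2 G d) * norm_Ld2 G d"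
        using inner_Ld2_nonneg[OF G] by (intro mult_right_mono lip) (simp add: norm_Ld2_def)
      finally show ?thesis
        by (simp add: inner_Ld2_algebra[OF G] power2_eq_square mult_ac)
    qed
    ultimately show "\<exists>y. (\<psi> has_real_derivative y) (at t) \<and> y \<le> 0" by blast
  qed simp
  then show ?thesis
    by (simp add: \<psi>_def g_def flip: d_def)
qed

theorem theorem3p2:
  fixes G :: grid
    and \<nu>1 \<nu>2 \<nu>3 :: "arr \<Rightarrow> real"
    and L \<mu>2 \<mu>3 \<Delta>t :: real
    and U :: "nat \<Rightarrow> arr"
  assumes "valid_grid G"
    and "L_smooth G L \<nu>1"
    and "strongly_convex G \<mu>2 \<nu>2"
    and "strongly_convex G \<mu>3 \<nu>3"
    and "\<mu>2 \<ge> 0"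
    and "\<Delta>t > 0"
    and "\<And>n. U n \<in> Ld2 G"
    and "\<And>n. (1 / \<Delta>t) *\<^sub>a (U (Suc n) - U n) =
           - (grad_Ld2 G \<nu>1 (U n) + grad_Ld2 G \<nu>2 (U (Suc n)) - grad_Ld2 G \<nu>3 (U n))"
    and "L \<le> \<mu>2 + \<mu>3 \<or> (L > \<mu>2 + \<mu>3 \<and> \<Delta>t \<le> 2 / (L - \<mu>2 - \<mu>3))"
  shows "decseq (\<lambda>n. (\<nu>1 + \<nu>2 - \<nu>3) (U n))"
proof (rule decseq_SucI)
  fix n
  note G = assms(1)
  define a where "a = U n"
  define b where "b = U (Suc n)"
  define Q where "Q = (norm_Ld2 G (b - a))\<^sup>2"
  let ?g1 = "grad_Ld2 G \<nu>1 a" and ?g2 = "grad_Ld2 G \<nu>2 b" and ?g3 = "grad_Ld2 G \<nu>3 a"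
  have mem: "a \<in> Ld2 G" "b \<in> Ld2 G"
    using assms(7) by (simp_all add: a_def b_def)
  have Q: "Q = inner_Ld2 G (b - a) (b - a)" "Q \<ge> 0"
    by (simp_all add: Q_def norm_Ld2_squared[OF G] inner_Ld2_nonneg[OF G])
  have 1: "\<nu>1 b \<le> \<nu>1 a + inner_Ld2 G ?g1 (b - a) + L / 2 * Q"
    unfolding Q_def by (rule descent_lemma[OF G assms(2) mem])
  \<comment> \<open>The convexity inequality of \<open>\<nu>2\<close> is based at the new point
    \<open>b\<close> and looks back to \<open>a\<close>, so it is first rewritten in terms of
    \<open>b - a\<close>.\<close>
  have "a - b = - (b - a)"
    by simp
  then have "(norm_Ld2 G (a - b))\<^sup>2 = Q"
    by (simp only: Q(1) norm_Ld2_squared[OF G] inner_Ld2_algebra(4,5)[OF G] minus_minus)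
  moreover have "inner_Ld2 G ?g2 (a - b) = - inner_Ld2 G ?g2 (b - a)"
    by (simp only: \<open>a - b = - (b - a)\<close> inner_Ld2_algebra(5)[OF G])
  ultimately have 2: "\<nu>2 a \<ge> \<nu>2 b - inner_Ld2 G ?g2 (b - a) + \<mu>2 / 2 * Q"
    using assms(3) mem by (fastforce simp: strongly_convex_def)
  have 3: "\<nu>3 b \<ge> \<nu>3 a + inner_Ld2 G ?g3 (b - a) + \<mu>3 / 2 * Q"
    using assms(4) mem by (simp add: strongly_convex_def Q_def)
  \<comment> \<open>Pairing the scheme with the increment \<open>b - a\<close> turns it into a
    scalar identity for the three first-order terms.\<close>
  have "inner_Ld2 G ((1 / \<Delta>t) *\<^sub>a (b - a)) (b - a) =
      inner_Ld2 G (- (?g1 + ?g2 - ?g3)) (b - a)"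
    using assms(8)[of n] by (simp only: a_def b_def)
  then have "inner_Ld2 G ?g1 (b - a) + inner_Ld2 G ?g2 (b - a) - inner_Ld2 G ?g3 (b - a) =
      - (1 / \<Delta>t) * Q"
    by (simp only: inner_Ld2_algebra(1,2,4,6)[OF G] Q(1))
  with 1 2 3 have "\<nu>1 b + \<nu>2 b - \<nu>3 b \<le>
      \<nu>1 a + \<nu>2 a - \<nu>3 a + ((L - \<mu>2 - \<mu>3) / 2 - 1 / \<Delta>t) * Q"
    by (simp add: algebra_simps diff_divide_distrib add_divide_distrib)
  \<comment> \<open>If \<open>L \<le> \<mu>2 + \<mu>3\<close>, the first term is nonpositive and the
    subtracted one positive. Otherwise this is the step size bound with denominators
    cleared.\<close>
  moreover have "(L - \<mu>2 - \<mu>3) / 2 - 1 / \<Delta>t \<le> 0"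
  proof (cases "L \<le> \<mu>2 + \<mu>3")
    case True
    then have "(L - \<mu>2 - \<mu>3) / 2 \<le> 0" "1 / \<Delta>t > 0"
      using assms(6) by auto
    then show ?thesis by linarith
  next
    case False
    then show ?thesis
      using assms(6,9) by (auto simp: field_simps)
  qed
  ultimately show "(\<nu>1 + \<nu>2 - \<nu>3) (U (Suc n)) \<le> (\<nu>1 + \<nu>2 - \<nu>3) (U n)"
    using mult_nonpos_nonneg[OF _ Q(2)] by (fastforce simp flip: a_def b_def)
qed

end
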